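(* Let $(\overline{\mathfrak{g}},\overline\alpha,\overline\omega)$ be a cosymplectic Lie algebra with Reeb vector $\overline\xi$ and bracket $\overline{[\,,\,]}$, and let $\overline{\mathfrak{h}}=\ker\overline\alpha$. Let $D=(\varphi,\lambda,v,t)\in \mathrm{End}(\overline{\mathfrak{g}})\times\overline{\mathfrak{g}}^*\times\overline{\mathfrak{g}}\times\mathbb{R}$ satisfy: (i) $\overline\omega(\varphi(x),y)=-\overline\omega(x,\varphi(y))$ for all $x,y\in\overline{\mathfrak{h}}$; (ii) $\lambda(x)=\overline\omega(x,\varphi(\overline\xi))$ for all $x\in\overline{\mathfrak{h}}$; (iii) $\overline\omega(v,x)=\overline\alpha(\varphi(x))$ for all $x\in\overline{\mathfrak{h}}$; (iv) $t=-\overline\alpha(\varphi(\overline\xi))$. Let $\mathfrak{g}=\langle d\rangle\oplus\overline{\mathfrak{g}}\oplus\langle e\rangle$ be equipped with the alternating bilinear bracket of the double extension of $\overline{\mathfrak{g}}$ by $(D,\theta=0)$, that is, $$[x,y]=\overline{[x,y]},\quad [x,e]=0,\quad [d,x]=\varphi(x)+\lambda(x)e,\quad [d,e]=v+te,\qquad x,y\in\overline{\mathfrak{g}}.$$ Then $\omega=\overline\omega+\overline\alpha\wedge e^*$ and $\alpha=d^*$ define a cosymplectic structure on $\mathfrak{g}$ (i.e. the bracket is a Lie bracket and $(\mathfrak{g},\alpha,\omega)$ is a cosymplectic Lie algebra) if and only if 1. $\varphi\in\mathrm{Der}(\overline{\mathfrak{g}})$; 2. $v\in Z(\overline{\mathfrak{g}})$;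 3. $\overline{R}_{\varphi(\overline\xi)}=0$ and $\overline{[\varphi(\overline\xi),\overline\xi]}=0$. Also, the Reeb vector is $d$.
   Context: A cosymplectic Lie algebra $(\mathfrak{g},\alpha,\omega)$ is a real Lie algebra of dimension $2n+1$ with $\alpha\in\mathfrak{g}^*$ and $\omega\in\wedge^2\mathfrak{g}^*$ such that $\alpha([x,y])=0$, $\omega([x,y],z)+\omega([y,z],x)+\omega([z,x],y)=0$ for all $x,y,z$, and $\alpha\wedge\omega^n\neq0$. Its Reeb vector $\xi$ is the unique vector with $\alpha(\xi)=1$, $\iota_\xi\omega=0$. The forms $\overline\alpha,\overline\omega$ are extended to $\langle d\rangle\oplus\overline{\mathfrak{g}}\oplus\langle e\rangle$ by zero on $d,e$, and $d^*,e^*$ are the linear forms dual to $d,e$ vanishing on the other summands. $\overline{\mathfrak{h}}$ is an ideal of $\overline{\mathfrak{g}}$ on which $\overline\omega$ is non-degenerate. The left-symmetric product $*$ associated with the symplectic Lie algebra $(\overline{\mathfrak{h}},\overline\omega)$ is defined by $\overline\omega(y*x,z)=-\overline\omega(x,\overline{[y,z]})$ for $y,z\in\overline{\mathfrak{h}}$; the same formula defines $y*x\in\overline{\mathfrak{h}}$ for $y\in\overline{\mathfrak{h}}$ and any $x\in\overline{\mathfrak{g}}$. $\overline{R}_x:\overline{\mathfrak{h}}\to\overline{\mathfrak{h}}$, $\overline{R}_x y=y*x$. $Z(\overline{\mathfrak{g}})$ is the center and $\mathrm{Der}(\overline{\mathfrak{g}})$ the space of derivations. *)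

theory Defs
  imports "HOL-Analysis.Analysis" "HOL-Combinatorics.Permutations"
begin

text \<open>
  A Lie algebra is a bracket on a whole type of class \<^class>\<open>real_vector\<close>.
  Finite-dimensionality is not built into the type: it follows from
  \<^term>\<open>dim (UNIV :: 'a::real_vector set) = 2 * n + 1\<close> below, since the library
  sets the dimension of an infinite-dimensional space to 0.
\<close>

definition lie_algebra :: "('a::real_vector \<Rightarrow> 'a \<Rightarrow> 'a) \<Rightarrow> bool" where
  "lie_algebra br \<longleftrightarrow>
     bilinear br \<and> (\<forall>x. br x x = 0) \<and>
     (\<forall>x y z. br (br x y) z + br (br y z) x + br (br z x) y = 0)"

definition derivations :: "('a::real_vector \<Rightarrow> 'a \<Rightarrow> 'a) \<Rightarrow> ('a \<Rightarrow> 'a) set" where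
  "derivations br = {f. linear f \<and> (\<forall>x y. f (br x y) = br (f x) y + br x (f y))}"

definition lie_center :: "('a::real_vector \<Rightarrow> 'a \<Rightarrow> 'a) \<Rightarrow> 'a set" where
  "lie_center br = {z. \<forall>x. br z x = 0}"

definition alternating_form :: "('a::real_vector \<Rightarrow> 'a \<Rightarrow> real) \<Rightarrow> bool" where
  "alternating_form \<omega> \<longleftrightarrow> bilinear \<omega> \<and> (\<forall>x. \<omega> x x = 0)"

text \<open>
  A \<open>k\<close>-form is encoded as a function of a sequence \<open>v\<close> of vectors that depends
  only on \<open>v 0, \<dots>, v (k - 1)\<close>.  The wedge product of a \<open>k\<close>-form and an \<open>l\<close>-form is
  normalised by \<open>1 / (k! l!)\<close>, so that \<open>a \<and> b\<close> takes \<open>(x, y)\<close> to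
  \<open>a x * b y - a y * b x\<close> for 1-forms \<open>a\<close>, \<open>b\<close>.
\<close>

definition wedge ::
    "nat \<Rightarrow> nat \<Rightarrow> ((nat \<Rightarrow> 'a) \<Rightarrow> real) \<Rightarrow> ((nat \<Rightarrow> 'a) \<Rightarrow> real) \<Rightarrow> (nat \<Rightarrow> 'a) \<Rightarrow> real" where
  "wedge k l \<eta> \<zeta> v =
     (\<Sum>p | p permutes {..<k + l}.
        of_int (sign p) * \<eta> (\<lambda>i. v (p i)) * \<zeta> (\<lambda>i. v (p (k + i)))) / (fact k * fact l)"

definition form1 :: "('a \<Rightarrow> real) \<Rightarrow> (nat \<Rightarrow> 'a) \<Rightarrow> real" where
  "form1 \<alpha> v = \<alpha> (v 0)"

definition form2 :: "('a \<Rightarrow> 'a \<Rightarrow> real) \<Rightarrow> (nat \<Rightarrow> 'a) \<Rightarrow> real" where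
  "form2 \<omega> v = \<omega> (v 0) (v 1)"

primrec wedge_power2 :: "('a \<Rightarrow> 'a \<Rightarrow> real) \<Rightarrow> nat \<Rightarrow> (nat \<Rightarrow> 'a) \<Rightarrow> real" where
  "wedge_power2 \<omega> 0 = (\<lambda>v. 1)"
| "wedge_power2 \<omega> (Suc n) = wedge 2 (2 * n) (form2 \<omega>) (wedge_power2 \<omega> n)"

definition cosymplectic_lie_algebra ::
    "('a::real_vector \<Rightarrow> 'a \<Rightarrow> 'a) \<Rightarrow> ('a \<Rightarrow> real) \<Rightarrow> ('a \<Rightarrow> 'a \<Rightarrow> real) \<Rightarrow> bool" where
  "cosymplectic_lie_algebra br \<alpha> \<omega> \<longleftrightarrow>
     lie_algebra br \<and> linear \<alpha> \<and> alternating_form \<omega> \<and>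
     (\<forall>x y. \<alpha> (br x y) = 0) \<and>
     (\<forall>x y z. \<omega> (br x y) z + \<omega> (br y z) x + \<omega> (br z x) y = 0) \<and>
     (\<exists>n. dim (UNIV :: 'a set) = 2 * n + 1 \<and>
          wedge 1 (2 * n) (form1 \<alpha>) (wedge_power2 \<omega> n) \<noteq> (\<lambda>v. 0))"

definition reeb_vector :: "('a::real_vector \<Rightarrow> real) \<Rightarrow> ('a \<Rightarrow> 'a \<Rightarrow> real) \<Rightarrow> 'a" where
  "reeb_vector \<alpha> \<omega> = (THE \<xi>. \<alpha> \<xi> = 1 \<and> (\<forall>x. \<omega> \<xi> x = 0))"

text \<open>
  The left-symmetric product \<open>y * x\<close> of \<open>y \<in> h\<close> and an arbitrary \<open>x\<close>: the element of \<open>h\<close>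
  with \<open>\<omega> (y * x) z = - \<omega> x [y, z]\<close> for \<open>z \<in> h\<close>.  The description is proper when \<open>\<omega>\<close> is
  non-degenerate on the finite-dimensional ideal \<open>h\<close>.
\<close>

definition left_symmetric_product ::
    "('a::real_vector \<Rightarrow> 'a \<Rightarrow> 'a) \<Rightarrow> ('a \<Rightarrow> 'a \<Rightarrow> real) \<Rightarrow> 'a set \<Rightarrow> 'a \<Rightarrow> 'a \<Rightarrow> 'a" where
  "left_symmetric_product br \<omega> h y x =
     (THE w. w \<in> h \<and> (\<forall>z\<in>h. \<omega> w z = - \<omega> x (br y z)))"

definition right_mult ::
    "('a::real_vector \<Rightarrow> 'a \<Rightarrow> 'a) \<Rightarrow> ('a \<Rightarrow> 'a \<Rightarrow> real) \<Rightarrow> 'a set \<Rightarrow> 'a \<Rightarrow> 'a \<Rightarrow> 'a" where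
  "right_mult br \<omega> h x = (\<lambda>y. left_symmetric_product br \<omega> h y x)"

text \<open>
  The triple \<open>(a, x, b)\<close> stands for \<open>a d + x + b e\<close> in \<open>\<langle>d\<rangle> \<oplus> g \<oplus> \<langle>e\<rangle>\<close>.
\<close>

definition ext_d :: "real \<times> 'a::real_vector \<times> real" where
  "ext_d = (1, 0, 0)"

definition ext_e :: "real \<times> 'a::real_vector \<times> real" where
  "ext_e = (0, 0, 1)"

definition ext_in :: "'a::real_vector \<Rightarrow> real \<times> 'a \<times> real" where
  "ext_in x = (0, x, 0)"

definition dual_d :: "real \<times> 'a::real_vector \<times> real \<Rightarrow> real" where
  "dual_d u = fst u"

definition dual_e :: "real \<times> 'a::real_vector \<times> real \<Rightarrow> real" where
  "dual_e u = snd (snd u)"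

definition ext_form1 :: "('a::real_vector \<Rightarrow> real) \<Rightarrow> real \<times> 'a \<times> real \<Rightarrow> real" where
  "ext_form1 \<alpha> u = \<alpha> (fst (snd u))"

definition ext_form2 ::
    "('a::real_vector \<Rightarrow> 'a \<Rightarrow> real) \<Rightarrow> real \<times> 'a \<times> real \<Rightarrow> real \<times> 'a \<times> real \<Rightarrow> real" where
  "ext_form2 \<omega> u w = \<omega> (fst (snd u)) (fst (snd w))"

definition wedge11 :: "('a \<Rightarrow> real) \<Rightarrow> ('a \<Rightarrow> real) \<Rightarrow> 'a \<Rightarrow> 'a \<Rightarrow> real" where
  "wedge11 a b x y = a x * b y - a y * b x"

definition double_ext_form ::
    "('a::real_vector \<Rightarrow> real) \<Rightarrow> ('a \<Rightarrow> 'a \<Rightarrow> real) \<Rightarrow>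
     real \<times> 'a \<times> real \<Rightarrow> real \<times> 'a \<times> real \<Rightarrow> real" where
  "double_ext_form \<alpha> \<omega> u w = ext_form2 \<omega> u w + wedge11 (ext_form1 \<alpha>) dual_e u w"

text \<open>
  The bracket of the double extension by \<open>(\<phi>, lam, v, t)\<close> and \<open>\<theta> = 0\<close>: the bilinear
  alternating extension of its values on \<open>d\<close>, \<open>g\<close>, \<open>e\<close>, which are recovered in the
  lemmas following the definition.
\<close>

definition double_ext_bracket ::
    "('a::real_vector \<Rightarrow> 'a \<Rightarrow> 'a) \<Rightarrow> ('a \<Rightarrow> 'a) \<Rightarrow> ('a \<Rightarrow> real) \<Rightarrow> 'a \<Rightarrow> real \<Rightarrow>
     real \<times> 'a \<times> real \<Rightarrow> real \<times> 'a \<times> real \<Rightarrow> real \<times> 'a \<times> real" where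
  "double_ext_bracket br \<phi> lam v t = (\<lambda>(a, x, b) (a', x', b').
     (0,
      br x x' + a *\<^sub>R \<phi> x' - a' *\<^sub>R \<phi> x + (a * b' - a' * b) *\<^sub>R v,
      a * lam x' - a' * lam x + (a * b' - a' * b) * t))"

lemma double_ext_bracket_values:
  assumes "bilinear br" "linear \<phi>" "linear lam"
  shows "double_ext_bracket br \<phi> lam v t (ext_in x) (ext_in y) = ext_in (br x y)"
    and "double_ext_bracket br \<phi> lam v t (ext_in x) ext_e = 0"
    and "double_ext_bracket br \<phi> lam v t ext_d (ext_in x) = ext_in (\<phi> x) + lam x *\<^sub>R ext_e"
    and "double_ext_bracket br \<phi> lam v t ext_d ext_e = ext_in v + t *\<^sub>R ext_e"
  using assms
  by (simp_all add: double_ext_bracket_def ext_in_def ext_d_def ext_e_def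
      bilinear_lzero bilinear_rzero linear_0 zero_prod_def)

lemma double_ext_bracket_alternating:
  assumes "\<And>x. br x x = 0"
  shows "double_ext_bracket br \<phi> lam v t u u = 0"
  using assms
  by (cases u) (simp add: double_ext_bracket_def zero_prod_def)

lemma bilinear_double_ext_bracket:
  assumes "bilinear br" "linear \<phi>" "linear lam"
  shows "bilinear (double_ext_bracket br \<phi> lam v t)"
  unfolding bilinear_def
proof (intro conjI allI)
  note simps = double_ext_bracket_def split_beta bilinear_ladd[OF assms(1)]
    bilinear_radd[OF assms(1)] bilinear_lmul[OF assms(1)] bilinear_rmul[OF assms(1)]
    linear_add[OF assms(2)] linear_add[OF assms(3)]
    linear_scale[OF assms(2)] linear_scale[OF assms(3)] prod_eq_iff algebra_simps
  show "linear (\<lambda>y. double_ext_bracket br \<phi> lam v t u y)" for u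
    by (rule linearI) (simp_all add: simps)
  show "linear (\<lambda>x. double_ext_bracket br \<phi> lam v t x w)" for w
    by (rule linearI) (simp_all add: simps)
qed

lemma wedge_form1_form1: "wedge 1 1 (form1 a) (form1 b) = form2 (wedge11 a b)"
proof
  fix v :: "nat \<Rightarrow> 'a"
  have "{..<1 + 1} = {0, 1::nat}"
    by auto
  then have "{p. p permutes {..<1 + 1 :: nat}} = {id, Transposition.transpose 0 1}"
    by (auto simp: permutes_doubleton_iff)
  moreover have "id \<noteq> Transposition.transpose 0 (1::nat)"
    by (metis id_apply transpose_apply_first zero_neq_one)
  ultimately show "wedge 1 1 (form1 a) (form1 b) v = form2 (wedge11 a b) v"
    by (simp add: wedge_def form1_def form2_def wedge11_def sign_swap_id)
qed

end

theory Submission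
  imports Defs
begin

text \<open>
  The hypotheses on \<open>(\<phi>, lam, v, t)\<close> say exactly that the extended 2-form is closed for the extended
  bracket, and \<open>d\<^sup>*\<close> always vanishes on brackets.  The volume form is inherited: contracting
  \<open>d\<^sup>* \<and> (\<omega> + \<alpha> \<and> e\<^sup>*)\<^sup>n\<^sup>+\<^sup>1\<close> with \<open>d\<close> and then \<open>e\<close> gives \<open>- (n + 1) \<alpha> \<and> \<omega>\<^sup>n\<close> on the
  original algebra.  So only the Jacobi identity matters; it amounts to \<open>\<phi>\<close> being a derivation,
  \<open>v\<close> being central and \<open>lam\<close> vanishing on brackets.
  Since \<open>lam (br x y) = \<omega> (br x y) (\<phi> \<xi>)\<close>, the last condition for \<open>x\<close>, \<open>y\<close> in the kernel of \<open>\<alpha>\<close>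
  is the vanishing of the right multiplication by \<open>\<phi> \<xi>\<close>, and for \<open>y = \<xi>\<close> the cocycle identity and
  non-degeneracy turn it into \<open>br (\<phi> \<xi>) \<xi> = 0\<close>.
\<close>

subsection \<open>Alternating sums over permutations\<close>

text \<open>Antisymmetrization of an arbitrary \<open>F\<close> without a normalising factor, so
  that sums can be nested and reindexed first and the factorials of \<open>wedge\<close> settled
  separately.\<close>

definition alternate :: "nat \<Rightarrow> ((nat \<Rightarrow> 'a) \<Rightarrow> real) \<Rightarrow> (nat \<Rightarrow> 'a) \<Rightarrow> real" where
  "alternate m F v = (\<Sum>p | p permutes {..<m}. of_int (sign p) * F (\<lambda>i. v (p i)))"

lemma sign_mult_self_real [simp]: "real_of_int (sign p) * (real_of_int (sign p) * c) = c"
  by (simp add: sign_def)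

lemma alternate_permute:
  assumes "q permutes {..<m}"
  shows "alternate m F (\<lambda>i. v (q i)) = of_int (sign q) * alternate m F v"
proof -
  have "alternate m F v =
      (\<Sum>p | p permutes {..<m}. of_int (sign (q \<circ> p)) * F (\<lambda>i. v ((q \<circ> p) i)))"
    unfolding alternate_def
    by (rule setum_permutations_compose_left [OF assms])
  also have "\<dots> = (\<Sum>p | p permutes {..<m}.
      of_int (sign q) * (of_int (sign p) * F (\<lambda>i. v (q (p i)))))"
    using assms by (intro sum.cong)
      (auto simp: sign_compose permutes_imp_permutation[OF finite_lessThan])
  finally show ?thesis
    by (simp add: alternate_def flip: sum_distrib_left)
qed

text \<open>Here \<open>q\<close> acts on the slots of \<open>F\<close> instead of the indices of
  the vectors, so the sum is reindexed by composition on the right instead of the left.\<close>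

lemma alternate_permute_form:
  assumes "q permutes {..<m}"
  shows "alternate m (\<lambda>u. F (\<lambda>i. u (q i))) v = of_int (sign q) * alternate m F v"
proof -
  have "alternate m F v =
      (\<Sum>p | p permutes {..<m}. of_int (sign (p \<circ> q)) * F (\<lambda>i. v ((p \<circ> q) i)))"
    unfolding alternate_def
    by (rule sum_permutations_compose_right [OF assms])
  also have "\<dots> = (\<Sum>p | p permutes {..<m}.
      of_int (sign q) * (of_int (sign p) * F (\<lambda>i. v (p (q i)))))"
    using assms by (intro sum.cong)
      (auto simp: sign_compose permutes_imp_permutation[OF finite_lessThan])
  finally show ?thesis
    by (simp add: alternate_def flip: sum_distrib_left)
qed

text \<open>The transposition of \<open>i\<close> and \<open>j\<close> leaves \<open>v\<close>
  unchanged but reverses the sign of the sum.\<close>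

lemma alternate_eq_0_if_repeated:
  assumes "i < m" "j < m" "i \<noteq> j" "v i = v j"
  shows "alternate m F v = 0"
proof -
  have "(\<lambda>k. v (Transposition.transpose i j k)) = v"
    using assms(4) by (auto simp: fun_eq_iff Transposition.transpose_def)
  moreover have "Transposition.transpose i j permutes {..<m}"
    using assms by (intro permutes_swap_id) auto
  ultimately show ?thesis
    using alternate_permute[of "Transposition.transpose i j" m F v] assms(3)
    by (simp add: sign_swap_id)
qed

section \<open>Permutations shifted past a fixed initial segment\<close>

definition shift_perm :: "nat \<Rightarrow> (nat \<Rightarrow> nat) \<Rightarrow> nat \<Rightarrow> nat" where
  "shift_perm k q i = (if i < k then i else k + q (i - k))"

lemma permutes_if_bij: "bij p \<Longrightarrow> (\<And>x. x \<notin> S \<Longrightarrow> p x = x) \<Longrightarrow> p permutes S"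
  by (simp add: permutes_def bij_iff)

text \<open>If \<open>q\<close> is a permutation, preimages above \<open>k\<close> come from
  \<open>inv q\<close>. The converse serves to recognise every permutation fixing 0 as a shift by
  one.\<close>

lemma shift_perm_permutes_iff:
  "shift_perm k q permutes {..<k + l} \<longleftrightarrow> q permutes {..<l}"
proof
  assume q: "q permutes {..<l}"
  show "shift_perm k q permutes {..<k + l}"
  proof (rule permutes_if_bij)
    show "bij (shift_perm k q)"
    proof (rule bijI')
      show "shift_perm k q x = shift_perm k q y \<longleftrightarrow> x = y" for x y
        by (auto simp: shift_perm_def inj_eq[OF permutes_inj[OF q]])
      show "\<exists>x. y = shift_perm k q x" for y
      proof (cases "y < k")
        case True
        then show ?thesis by (intro exI[of _ y]) (simp add: shift_perm_def)
      next
        case False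
        then show ?thesis
          using permutes_inverses(1)[OF q]
          by (intro exI[of _ "k + inv q (y - k)"]) (simp add: shift_perm_def)
      qed
    qed
    show "shift_perm k q x = x" if "x \<notin> {..<k + l}" for x
      using permutes_not_in[OF q, of "x - k"] that by (auto simp: shift_perm_def)
  qed
next
  assume p: "shift_perm k q permutes {..<k + l}"
  have eq: "shift_perm k q (k + i) = k + q i" for i
    by (simp add: shift_perm_def)
  show "q permutes {..<l}"
  proof (rule permutes_if_bij)
    show "bij q"
    proof (rule bijI')
      show "q x = q y \<longleftrightarrow> x = y" for x y
        using permutes_inj[OF p] eq[of x] eq[of y] by (metis add_left_cancel injD)
      fix y
      obtain x where x: "shift_perm k q x = k + y"
        using permutes_surj[OF p] by (metis surj_def)
      then have "k \<le> x"
        by (auto simp: shift_perm_def split: if_splits)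
      with x show "\<exists>x. y = q x"
        by (intro exI[of _ "x - k"]) (simp add: shift_perm_def)
    qed
    show "q x = x" if "x \<notin> {..<l}" for x
      using permutes_not_in[OF p, of "k + x"] that eq by auto
  qed
qed

text \<open>Shifting turns the transposition of \<open>a\<close> and \<open>b\<close> into that of
  \<open>k + a\<close> and \<open>k + b\<close>, so the signs agree by induction over
  transpositions.\<close>

lemma sign_shift_perm:
  assumes "q permutes {..<l}"
  shows "sign (shift_perm k q) = sign q"
  using assms finite_lessThan
proof (induction rule: permutes_induct)
  case id
  have "shift_perm k id = id" by (auto simp: shift_perm_def)
  then show ?case by (simp only: sign_id)
next
  case (swap a b p)
  have "shift_perm k (Transposition.transpose a b \<circ> p) =
      Transposition.transpose (k + a) (k + b) \<circ> shift_perm k p"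
    by (auto simp: shift_perm_def fun_eq_iff Transposition.transpose_def)
  moreover have "permutation (shift_perm k p)" "permutation p"
    using swap shift_perm_permutes_iff permutes_imp_permutation finite_lessThan by blast+
  ultimately show ?case
    using swap sign_compose[of "Transposition.transpose (k + a) (k + b)" "shift_perm k p"]
      sign_compose[of "Transposition.transpose a b" p]
    by (simp only: sign_swap_id permutation_swap_id) simp
qed

text \<open>An inner permutation, shifted by \<open>k\<close>, is absorbed into the outer one:
  \<open>\<eta>\<close> sees only the first \<open>k\<close> entries, which the shift fixes, and the
  two signs cancel. Hence all \<open>l!\<close> inner terms contribute equally.\<close>

lemma alternate_nested:
  assumes "\<And>u w. (\<And>i. i < k \<Longrightarrow> u i = w i) \<Longrightarrow> \<eta> u = \<eta> w"
  shows "alternate (k + l) (\<lambda>u. \<eta> u * alternate l Z (\<lambda>i. u (k + i))) v =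
    fact l * alternate (k + l) (\<lambda>u. \<eta> u * Z (\<lambda>i. u (k + i))) v"
proof -
  let ?F = "\<lambda>u. \<eta> u * Z (\<lambda>i. u (k + i))"
  have eta: "\<eta> (\<lambda>i. u (shift_perm k q i)) = \<eta> u" for u q
    by (rule assms) (simp add: shift_perm_def)
  have "alternate (k + l) (\<lambda>u. \<eta> u * alternate l Z (\<lambda>i. u (k + i))) v =
     (\<Sum>p | p permutes {..<k + l}. \<Sum>q | q permutes {..<l}.
        of_int (sign q) * (of_int (sign p) * ?F (\<lambda>i. v (p (shift_perm k q i)))))"
    by (simp add: alternate_def sum_distrib_left eta[of "\<lambda>i. v (_ i)"] shift_perm_def[of k _ "k + _"]
        mult_ac)
  also have "\<dots> = (\<Sum>q | q permutes {..<l}. of_int (sign q) *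
      alternate (k + l) (\<lambda>u. ?F (\<lambda>i. u (shift_perm k q i))) v)"
    unfolding alternate_def sum_distrib_left by (rule sum.swap)
  also have "\<dots> = (\<Sum>q | q permutes {..<l}. alternate (k + l) ?F v)"
  proof (rule sum.cong[OF refl])
    fix q assume "q \<in> {q. q permutes {..<l}}"
    then have q: "q permutes {..<l}" by simp
    show "of_int (sign q) * alternate (k + l) (\<lambda>u. ?F (\<lambda>i. u (shift_perm k q i))) v
        = alternate (k + l) ?F v"
      using alternate_permute_form[of "shift_perm k q" "k + l" ?F v] q
      by (simp add: shift_perm_permutes_iff sign_shift_perm)
  qed
  finally show ?thesis
    by (simp add: card_permutations[OF card_lessThan])
qed

subsection \<open>Wedge powers as alternating sums\<close>

definition pair_prod :: "('a \<Rightarrow> 'a \<Rightarrow> real) \<Rightarrow> nat \<Rightarrow> (nat \<Rightarrow> 'a) \<Rightarrow> real" where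
  "pair_prod \<omega> n u = (\<Prod>i<n. \<omega> (u (2 * i)) (u (Suc (2 * i))))"

definition linear_pair_prod ::
    "('a \<Rightarrow> real) \<Rightarrow> ('a \<Rightarrow> 'a \<Rightarrow> real) \<Rightarrow> nat \<Rightarrow> (nat \<Rightarrow> 'a) \<Rightarrow> real" where
  "linear_pair_prod \<alpha> \<omega> n u = \<alpha> (u 0) * pair_prod \<omega> n (\<lambda>i. u (Suc i))"

lemma pair_prod_Suc_shift: "pair_prod \<omega> (Suc n) u = \<omega> (u 0) (u 1) * pair_prod \<omega> n (\<lambda>i. u (2 + i))"
  by (simp add: pair_prod_def prod.lessThan_Suc_shift del: prod.lessThan_Suc)

lemma wedge_eq_alternate:
  "wedge k l \<eta> \<zeta> v = alternate (k + l) (\<lambda>u. \<eta> u * \<zeta> (\<lambda>i. u (k + i))) v / (fact k * fact l)"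
  by (simp add: wedge_def alternate_def mult.assoc)

lemma alternate_divide: "alternate m (\<lambda>u. F u / c) v = alternate m F v / c"
  by (simp add: alternate_def sum_divide_distrib)

text \<open>Each wedge with \<open>\<omega>\<close> divides by \<open>2! (2n)!\<close>; the nested
  alternation gives back \<open>(2n)!\<close>, so one factor 2 per step remains.\<close>

lemma wedge_power2_eq_alternate:
  "wedge_power2 \<omega> n = (\<lambda>v. alternate (2 * n) (pair_prod \<omega> n) v / 2 ^ n)"
proof (induction n)
  case 0
  then show ?case by (simp add: alternate_def pair_prod_def sign_id permutes_empty)
next
  case (Suc n)
  have "wedge_power2 \<omega> (Suc n) v = alternate (2 * Suc n) (pair_prod \<omega> (Suc n)) v / 2 ^ Suc n" for v
    using alternate_nested[of 2 "form2 \<omega>" "2 * n" "pair_prod \<omega> n" v]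
    by (simp add: wedge_eq_alternate Suc alternate_divide form2_def pair_prod_Suc_shift[abs_def])
  then show ?case by blast
qed

lemma wedge_form1_wedge_power2:
  "wedge 1 (2 * n) (form1 \<alpha>) (wedge_power2 \<omega> n) v =
    alternate (Suc (2 * n)) (linear_pair_prod \<alpha> \<omega> n) v / 2 ^ n"
  using alternate_nested[of 1 "form1 \<alpha>" "2 * n" "pair_prod \<omega> n" v]
  by (simp add: wedge_eq_alternate wedge_power2_eq_alternate alternate_divide form1_def
      linear_pair_prod_def[abs_def])

section \<open>Interior products of alternating sums\<close>

lemma alternate_Suc_fixing_0:
  "(\<Sum>p | p permutes {..<Suc m}. of_bool (p 0 = 0) * (of_int (sign p) * F (\<lambda>i. v (p i)))) =
    alternate m (\<lambda>u. F (case_nat (v 0) u)) (\<lambda>i. v (Suc i))"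
proof -
  \<comment> \<open>The permutations fixing 0 are exactly the shifts by one of permutations of the
    other \<open>m\<close> indices.\<close>
  have "bij_betw (shift_perm 1) {q. q permutes {..<m}} {p. p permutes {..<Suc m} \<and> p 0 = 0}"
  proof (rule bij_betwI')
    fix q r assume "q \<in> {q. q permutes {..<m}}" "r \<in> {q. q permutes {..<m}}"
    show "shift_perm 1 q = shift_perm 1 r \<longleftrightarrow> q = r"
      by (auto simp: shift_perm_def fun_eq_iff)
  next
    fix q assume "q \<in> {q. q permutes {..<m}}"
    then show "shift_perm 1 q \<in> {p. p permutes {..<Suc m} \<and> p 0 = 0}"
      using shift_perm_permutes_iff[of 1 q m] by (simp add: shift_perm_def)
  next
    fix p assume "p \<in> {p. p permutes {..<Suc m} \<and> p 0 = 0}"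
    then have p: "p permutes {..<Suc m}" "p 0 = 0" by auto
    then have nz: "p i \<noteq> 0" if "i \<noteq> 0" for i
      using permutes_inj[OF p(1)] that by (metis injD)
    \<comment> \<open>As \<open>p\<close> takes the value 0 at 0 only, the subtraction of 1 does not
      truncate.\<close>
    then have "p = shift_perm 1 (\<lambda>i. p (Suc i) - 1)"
      using p(2) by (auto simp: shift_perm_def fun_eq_iff)
    then show "\<exists>q\<in>{q. q permutes {..<m}}. p = shift_perm 1 q"
      using p shift_perm_permutes_iff[of 1 _ m] by (metis mem_Collect_eq plus_1_eq_Suc)
  qed
  from sum.reindex_bij_betw[OF this, of "\<lambda>p. of_int (sign p) * F (\<lambda>i. v (p i))"]
  have "(\<Sum>p | p permutes {..<Suc m} \<and> p 0 = 0. of_int (sign p) * F (\<lambda>i. v (p i))) =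
      (\<Sum>q | q permutes {..<m}. of_int (sign q) * F (\<lambda>i. v (shift_perm 1 q i)))"
    by (simp add: sign_shift_perm)
  moreover have "(\<lambda>i. v (shift_perm 1 q i)) = case_nat (v 0) (\<lambda>i. v (Suc (q i)))" for q
    by (auto simp: shift_perm_def fun_eq_iff split: nat.split)
  moreover have "(\<Sum>p | p permutes {..<Suc m}. of_bool (p 0 = 0) * (of_int (sign p) * F (\<lambda>i. v (p i)))) =
      (\<Sum>p | p permutes {..<Suc m} \<and> p 0 = 0. of_int (sign p) * F (\<lambda>i. v (p i)))"
    by (intro sum.mono_neutral_cong_right finite_permutations) auto
  ultimately show ?thesis
    by (simp add: alternate_def)
qed

text \<open>Every permutation \<open>p\<close> is counted once, namely at
  \<open>j = inv p 0\<close>.\<close>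

lemma alternate_split_preimage_0:
  assumes "0 < m"
  shows "alternate m F v =
    (\<Sum>j<m. \<Sum>p | p permutes {..<m}. of_bool (p j = 0) * (of_int (sign p) * F (\<lambda>i. v (p i))))"
proof -
  have "(\<Sum>j<m. of_bool (p j = 0) * c) = c" if p: "p permutes {..<m}" for p and c :: real
  proof -
    have "p j = 0 \<longleftrightarrow> j = inv p 0" for j
      using p by (metis permutes_inverses)
    moreover have "inv p 0 < m"
      using permutes_in_image[OF permutes_inv[OF p], of 0] assms by simp
    ultimately show ?thesis
      by (simp add: of_bool_def if_distrib[of "\<lambda>x. x * _"] cong: if_cong)
  qed
  then show ?thesis
    unfolding alternate_def by (subst sum.swap) (auto intro!: sum.cong)
qed

text \<open>Substituting \<open>p \<circ> s\<close> for \<open>p\<close> produces the sign of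
  \<open>s\<close> twice, once from the permutation and once from the symmetry of
  \<open>F\<close>.\<close>

lemma sum_preimage_0_permute:
  fixes m :: nat and F :: "(nat \<Rightarrow> 'a) \<Rightarrow> real"
  assumes "s permutes {..<m}" and "\<And>u. F (\<lambda>i. u (s i)) = of_int (sign s) * F u"
  shows "(\<Sum>p | p permutes {..<m}. of_bool (p (s j) = 0) * (of_int (sign p) * F (\<lambda>i. v (p i)))) =
    (\<Sum>p | p permutes {..<m}. of_bool (p j = 0) * (of_int (sign p) * F (\<lambda>i. v (p i))))"
  (is "?L = ?R")
proof -
  have "?R = (\<Sum>p | p permutes {..<m}.
      of_bool ((p \<circ> s) j = 0) * (of_int (sign (p \<circ> s)) * F (\<lambda>i. v ((p \<circ> s) i))))"
    by (rule sum_permutations_compose_right [OF assms(1)])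
  also have "\<dots> = ?L"
  proof (rule sum.cong[OF refl])
    fix p assume "p \<in> {p. p permutes {..<m}}"
    then have "sign (p \<circ> s) = sign p * sign s"
      using assms(1) sign_compose[OF permutes_imp_permutation permutes_imp_permutation, of "{..<m}" p "{..<m}" s]
      by simp
    then show "of_bool ((p \<circ> s) j = 0) * (of_int (sign (p \<circ> s)) * F (\<lambda>i. v ((p \<circ> s) i))) =
        of_bool (p (s j) = 0) * (of_int (sign p) * F (\<lambda>i. v (p i)))"
      using assms(2)[of "\<lambda>i. v (p i)"] by (simp add: mult.assoc)
  qed
  finally show ?thesis by simp
qed

lemma pair_prod_swap_in_pair:
  assumes "\<And>x y. \<omega> x y = - \<omega> y x" "i < n"
  shows "pair_prod \<omega> n (\<lambda>k. u (Transposition.transpose (2 * i) (Suc (2 * i)) k)) = - pair_prod \<omega> n u"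
proof -
  let ?s = "Transposition.transpose (2 * i) (Suc (2 * i))"
  have "\<omega> (u (?s (2 * k))) (u (?s (Suc (2 * k)))) =
      (if k = i then - 1 else 1) * \<omega> (u (2 * k)) (u (Suc (2 * k)))" for k
  proof (cases "k = i")
    case True
    then show ?thesis
      using assms(1)[of "u (Suc (2 * i))" "u (2 * i)"] by simp
  next
    case False
    then have "?s (2 * k) = 2 * k" "?s (Suc (2 * k)) = Suc (2 * k)"
      by (intro transpose_apply_other; presburger)+
    with False show ?thesis by simp
  qed
  then show ?thesis
    using assms(2) by (simp add: pair_prod_def prod.distrib)
qed

text \<open>The two transpositions exchange the pairs 0 and \<open>i\<close> as blocks, so the
  factors of the product are merely reordered.\<close>

lemma pair_prod_swap_pairs:
  assumes "i < n"
  shows "pair_prod \<omega> n (\<lambda>k. u ((Transposition.transpose 0 (2 * i) \<circ>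
    Transposition.transpose 1 (Suc (2 * i))) k)) = pair_prod \<omega> n u"
proof -
  let ?s = "Transposition.transpose 0 (2 * i) \<circ> Transposition.transpose 1 (Suc (2 * i))"
  let ?t = "Transposition.transpose 0 i"
  have "?s (2 * k) = 2 * ?t k" "?s (Suc (2 * k)) = Suc (2 * ?t k)" for k
    by (auto simp: Transposition.transpose_def) presburger+
  moreover have "bij_betw ?t {..<n} {..<n}"
    using assms by (intro permutes_imp_bij permutes_swap_id) auto
  then have "(\<Prod>k<n. \<omega> (u (2 * ?t k)) (u (Suc (2 * ?t k)))) = (\<Prod>k<n. \<omega> (u (2 * k)) (u (Suc (2 * k))))"
    by (rule prod.reindex_bij_betw)
  ultimately show ?thesis
    by (simp add: pair_prod_def)
qed

text \<open>
  Interior product: \<open>\<iota>\<^sub>x \<omega>\<^sup>n\<^sup>+\<^sup>1 = (n + 1) (\<iota>\<^sub>x \<omega>) \<and> \<omega>\<^sup>n\<close>.  A permutation may send any of the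
  \<open>2 n + 2\<close> positions to \<open>x\<close>; swapping pairs, or the two entries of a pair, shows that all
  positions contribute equally.
\<close>

lemma alternate_pair_prod_contract:
  assumes anti: "\<And>x y. \<omega> x y = - \<omega> y x"
  shows "alternate (2 * Suc n) (pair_prod \<omega> (Suc n)) v =
    real (2 * Suc n) * alternate (Suc (2 * n)) (linear_pair_prod (\<omega> (v 0)) \<omega> n) (\<lambda>i. v (Suc i))"
proof -
  let ?S = "\<lambda>j. \<Sum>p | p permutes {..<2 * Suc n}.
    of_bool (p j = 0) * (of_int (sign p) * pair_prod \<omega> (Suc n) (\<lambda>i. v (p i)))"
  have even_pos: "?S (2 * i) = ?S 0" if "i < Suc n" for i
  proof -
    let ?s = "Transposition.transpose 0 (2 * i) \<circ> Transposition.transpose 1 (Suc (2 * i))"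
    have "?s permutes {..<2 * Suc n}"
      using that by (intro permutes_compose permutes_swap_id) auto
    \<comment> \<open>For \<open>i = 0\<close> both transpositions are the identity; otherwise both
      are odd.\<close>
    moreover have "sign ?s = 1"
      by (simp add: sign_compose permutation_swap_id sign_swap_id)
    moreover have "?s 0 = 2 * i"
      by (simp add: Transposition.transpose_def)
    ultimately show ?thesis
      using sum_preimage_0_permute[of ?s "2 * Suc n" "pair_prod \<omega> (Suc n)" 0 v]
        pair_prod_swap_pairs[OF that, of \<omega>] by simp
  qed
  have odd_pos: "?S (Suc (2 * i)) = ?S (2 * i)" if "i < Suc n" for i
  proof -
    let ?s = "Transposition.transpose (2 * i) (Suc (2 * i))"
    have "?s permutes {..<2 * Suc n}"
      using that by (intro permutes_swap_id) auto
    moreover have "sign ?s = - 1"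
      by (simp add: sign_swap_id)
    ultimately show ?thesis
      using sum_preimage_0_permute[of ?s "2 * Suc n" "pair_prod \<omega> (Suc n)" "2 * i" v]
        pair_prod_swap_in_pair[of \<omega>, OF anti that] by simp
  qed
  have all_pos: "?S j = ?S 0" if "j < 2 * Suc n" for j
  proof (cases "even j")
    case True
    then obtain i where "j = 2 * i" by blast
    moreover from this that have "i < Suc n" by simp
    ultimately show ?thesis using even_pos by blast
  next
    case False
    then obtain i where j: "j = Suc (2 * i)" by (auto elim!: oddE)
    with that have "i < Suc n" by simp
    then show ?thesis
      unfolding j using even_pos odd_pos by (metis (no_types, lifting))
  qed
  have "alternate (2 * Suc n) (pair_prod \<omega> (Suc n)) v = (\<Sum>j<2 * Suc n. ?S j)"
    by (rule alternate_split_preimage_0) simp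
  also have "\<dots> = (\<Sum>j<2 * Suc n. ?S 0)"
    by (rule sum.cong[OF refl], rule all_pos) simp
  also have "\<dots> = real (2 * Suc n) * ?S 0"
    by (simp only: sum_constant card_lessThan)
  \<comment> \<open>With \<open>v 0\<close> fixed in the first slot, the leading factor becomes the
    linear form \<open>\<omega> (v 0)\<close>.\<close>
  also have "?S 0 = alternate (Suc (2 * n)) (linear_pair_prod (\<omega> (v 0)) \<omega> n) (\<lambda>i. v (Suc i))"
    using alternate_Suc_fixing_0[of "pair_prod \<omega> (Suc n)" v "Suc (2 * n)"]
    by (simp add: pair_prod_Suc_shift linear_pair_prod_def[abs_def])
  finally show ?thesis .
qed

text \<open>A permutation that moves \<open>d\<close> out of slot 0 feeds some \<open>w i\<close> to
  \<open>\<delta>\<close>, so only the permutations fixing 0 survive.\<close>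

lemma alternate_linear_pair_prod_annihilated:
  assumes "\<And>i. i < 2 * n \<Longrightarrow> \<delta> (w i) = 0"
  shows "alternate (Suc (2 * n)) (linear_pair_prod \<delta> \<omega> n) (case_nat d w) =
    \<delta> d * alternate (2 * n) (pair_prod \<omega> n) w"
proof -
  let ?F = "linear_pair_prod \<delta> \<omega> n"
  have "?F (\<lambda>i. case_nat d w (p i)) = 0" if p: "p permutes {..<Suc (2 * n)}" "p 0 \<noteq> 0" for p
  proof -
    have "p 0 < Suc (2 * n)" using permutes_in_image[OF p(1), of 0] by simp
    then show ?thesis
      using p(2) assms by (cases "p 0") (auto simp: linear_pair_prod_def)
  qed
  then have "alternate (Suc (2 * n)) ?F (case_nat d w) = (\<Sum>p | p permutes {..<Suc (2 * n)}.
      of_bool (p 0 = 0) * (of_int (sign p) * ?F (\<lambda>i. case_nat d w (p i))))"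
    unfolding alternate_def by (intro sum.cong) auto
  also have "\<dots> = alternate (2 * n) (\<lambda>u. \<delta> d * pair_prod \<omega> n u) w"
    by (subst alternate_Suc_fixing_0) (simp add: linear_pair_prod_def)
  also have "\<dots> = \<delta> d * alternate (2 * n) (pair_prod \<omega> n) w"
    by (simp add: alternate_def sum_distrib_left mult_ac)
  finally show ?thesis .
qed

subsection \<open>Multilinearity and dimension\<close>

lemma linear_mult_left_const: "linear f \<Longrightarrow> linear (\<lambda>x. c * f x :: real)"
  for f :: "'a::real_vector \<Rightarrow> real"
  by (simp add: linear_iff algebra_simps)

lemma linear_mult_right_const: "linear f \<Longrightarrow> linear (\<lambda>x. f x * c :: real)"
  for f :: "'a::real_vector \<Rightarrow> real"
  by (simp add: linear_iff algebra_simps)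

lemma pair_prod_upd_ge: "2 * n \<le> i \<Longrightarrow> pair_prod \<omega> n (u(i := x)) = pair_prod \<omega> n u"
  by (auto simp: pair_prod_def intro!: prod.cong)

lemma linear_pair_prod_upd:
  assumes "bilinear \<omega>" "i < 2 * n"
  shows "linear (\<lambda>x. pair_prod \<omega> n (u(i := x)))"
  using assms(2)
proof (induction n)
  case (Suc n)
  \<comment> \<open>Splitting off the last pair leaves the position \<open>i\<close> unshifted in
    the induction.\<close>
  have eq: "pair_prod \<omega> (Suc n) w = pair_prod \<omega> n w * \<omega> (w (2 * n)) (w (Suc (2 * n)))" for w
    by (simp add: pair_prod_def)
  consider "i < 2 * n" | "i = 2 * n" | "i = Suc (2 * n)"
    using Suc.prems by (auto simp: less_Suc_eq)
  then show ?case
  proof cases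
    case 1
    then show ?thesis
      unfolding eq using linear_mult_right_const[OF Suc.IH[OF 1]] by (simp add: fun_upd_def)
  next
    case 2
    then show ?thesis
      unfolding eq using assms(1)
      by (auto simp: pair_prod_upd_ge bilinear_def intro: linear_mult_left_const)
  next
    case 3
    then show ?thesis
      unfolding eq using assms(1)
      by (auto simp: pair_prod_upd_ge bilinear_def intro: linear_mult_left_const)
  qed
qed simp

lemma linear_linear_pair_prod_upd:
  assumes "linear \<alpha>" "bilinear \<omega>" "i < Suc (2 * n)"
  shows "linear (\<lambda>x. linear_pair_prod \<alpha> \<omega> n (u(i := x)))"
proof (cases i)
  case 0
  then show ?thesis
    using assms(1) by (simp add: linear_pair_prod_def linear_mult_right_const)
next
  case (Suc j)
  have "(\<lambda>k. (u(i := x)) (Suc k)) = (\<lambda>k. u (Suc k))(j := x)" for x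
    using Suc by auto
  then show ?thesis
    using assms Suc by (simp add: linear_pair_prod_def linear_mult_left_const linear_pair_prod_upd)
qed

lemma linear_alternate_upd:
  fixes v :: "nat \<Rightarrow> 'a::real_vector"
  assumes "\<And>u i. i < m \<Longrightarrow> linear (\<lambda>x. F (u(i := x)))" "i < m"
  shows "linear (\<lambda>x. alternate m F (v(i := x)))"
  unfolding alternate_def
proof (intro linear_compose_sum ballI linear_mult_left_const)
  fix p assume "p \<in> {p. p permutes {..<m}}"
  then have p: "p permutes {..<m}" by simp
  \<comment> \<open>After permuting by \<open>p\<close>, the entry of index \<open>i\<close> stands
    in slot \<open>inv p i\<close>.\<close>
  have "(\<lambda>j. (v(i := x)) (p j)) = (\<lambda>j. v (p j))(inv p i := x)" for x
    using permutes_inverses[OF p] by fastforce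
  moreover have "inv p i < m"
    using permutes_in_image[OF permutes_inv[OF p], of i] assms(2) by simp
  ultimately show "linear (\<lambda>x. F (\<lambda>j. (v(i := x)) (p j)))"
    using assms(1) by simp
qed

text \<open>Cramer's rule: after expansion in slot \<open>i\<close>, every summand with
  \<open>j \<noteq> i\<close> contains \<open>v j\<close> twice and vanishes.\<close>

lemma alternate_upd_sum:
  fixes v :: "nat \<Rightarrow> 'a::real_vector"
  assumes "\<And>u i. i < m \<Longrightarrow> linear (\<lambda>x. F (u(i := x)))" "i < m"
  shows "alternate m F (v(i := (\<Sum>j<m. c j *\<^sub>R v j))) = c i * alternate m F v"
proof -
  interpret L: linear "\<lambda>x. alternate m F (v(i := x))"
    by (rule linear_alternate_upd[OF assms])
  have "alternate m F (v(i := v j)) = (if j = i then alternate m F v else 0)" if "j < m" for j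
    using alternate_eq_0_if_repeated[of i m j "v(i := v j)" F] that assms(2) by auto
  then have "alternate m F (v(i := (\<Sum>j<m. c j *\<^sub>R v j))) =
      (\<Sum>j<m. if j = i then c i * alternate m F v else 0)"
    unfolding L.sum L.scale by (intro sum.cong) auto
  then show ?thesis
    using assms(2) by simp
qed

section \<open>Linear relations and dimension counts\<close>

lemma linear_relation_if_dim_less:
  fixes w :: "nat \<Rightarrow> 'a::real_vector"
  assumes "0 < dim (UNIV :: 'a set)" "dim (UNIV :: 'a set) < m"
  obtains c i where "i < m" "c i \<noteq> (0::real)" "(\<Sum>j<m. c j *\<^sub>R w j) = 0"
proof (cases "inj_on w {..<m}")
  case False
  then obtain i j where ij: "i < m" "j < m" "i \<noteq> j" "w i = w j"
    by (auto simp: inj_on_def)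
  let ?c = "\<lambda>k. if k = i then 1 else if k = j then - 1 else (0::real)"
  have "(\<Sum>k<m. ?c k *\<^sub>R w k) = (\<Sum>k\<in>{i, j}. ?c k *\<^sub>R w k)"
    using ij by (intro sum.mono_neutral_right) auto
  then show ?thesis
    using ij by (intro that[of i ?c]) auto
next
  case True
  obtain B :: "'a set" where B: "independent B" "UNIV \<subseteq> span B" "card B = dim (UNIV :: 'a set)"
    using basis_exists by metis
  \<comment> \<open>An infinite set has cardinality 0, so positive dimension forces a finite
    basis.\<close>
  then have "finite B"
    using assms(1) card_ge_0_finite by metis
  have "dependent (w ` {..<m})"
  proof (rule ccontr)
    assume "independent (w ` {..<m})"
    then have "card (w ` {..<m}) \<le> card B"
      using independent_span_bound[OF \<open>finite B\<close>] B(2) by blast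
    then show False
      using assms(2) B(3) card_image[OF True] by simp
  qed
  then obtain u where u: "(\<exists>x\<in>w ` {..<m}. u x \<noteq> 0)" "(\<Sum>x\<in>w ` {..<m}. u x *\<^sub>R x) = 0"
    by (auto simp: dependent_finite)
  from u(2) have "(\<Sum>j<m. u (w j) *\<^sub>R w j) = 0"
    by (simp add: sum.reindex[OF True])
  with u(1) show ?thesis
    by (auto intro: that[of _ "\<lambda>j. u (w j)"])
qed

text \<open>Too many vectors satisfy a linear relation. Put into a slot \<open>i\<close> with
  \<open>c i \<noteq> 0\<close>, it gives 0 by linearity and \<open>c i\<close> times the sum by
  Cramer's rule.\<close>

lemma alternate_eq_0_if_dim_less:
  fixes v :: "nat \<Rightarrow> 'a::real_vector"
  assumes "\<And>u i. i < m \<Longrightarrow> linear (\<lambda>x. F (u(i := x)))"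
    and "0 < dim (UNIV :: 'a set)" "dim (UNIV :: 'a set) < m"
  shows "alternate m F v = 0"
proof -
  obtain c i where c: "i < m" "c i \<noteq> (0::real)" "(\<Sum>j<m. c j *\<^sub>R v j) = 0"
    using linear_relation_if_dim_less[OF assms(2,3)] .
  interpret L: linear "\<lambda>x. alternate m F (v(i := x))"
    by (rule linear_alternate_upd[OF assms(1) c(1)])
  have "c i * alternate m F v = 0"
    using alternate_upd_sum[OF assms(1) c(1), where c = c and v = v] c(3) L.zero by simp
  then show ?thesis
    using c(2) by simp
qed

text \<open>The \<open>m + 1\<close> vectors \<open>x\<close>, \<open>v 0\<close>, ... satisfy a
  linear relation. By Cramer's rule the coefficient of each \<open>v i\<close> is governed by the
  sum with \<open>x\<close> in slot \<open>i\<close>, which is 0; what is left is a non-zero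
  multiple of \<open>x\<close>.\<close>

lemma alternate_degenerate:
  fixes v :: "nat \<Rightarrow> 'a::real_vector"
  assumes lin: "\<And>u i. i < m \<Longrightarrow> linear (\<lambda>x. F (u(i := x)))"
    and dim: "0 < dim (UNIV :: 'a set)" "dim (UNIV :: 'a set) = m"
    and kill: "\<And>u i. i < m \<Longrightarrow> u i = x \<Longrightarrow> alternate m F u = 0"
    and nz: "alternate m F v \<noteq> 0"
  shows "x = 0"
proof -
  obtain c k where c: "k < Suc m" "c k \<noteq> (0::real)" "(\<Sum>j<Suc m. c j *\<^sub>R (case_nat x v) j) = 0"
    by (rule linear_relation_if_dim_less[of "Suc m" "case_nat x v"]) (use dim in auto)
  then have rel: "(\<Sum>j<m. c (Suc j) *\<^sub>R v j) = - c 0 *\<^sub>R x"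
    by (simp add: sum.lessThan_Suc_shift add_eq_0_iff del: sum.lessThan_Suc)
  have c_Suc: "c (Suc i) = 0" if i: "i < m" for i
  proof -
    interpret L: linear "\<lambda>x. alternate m F (v(i := x))"
      by (rule linear_alternate_upd[OF lin i])
    have "c (Suc i) * alternate m F v = alternate m F (v(i := - c 0 *\<^sub>R x))"
      using alternate_upd_sum[OF lin i, where c = "\<lambda>j. c (Suc j)" and v = v] rel by simp
    also have "\<dots> = 0"
      unfolding L.scale using kill[OF i, of "v(i := x)"] by simp
    finally show ?thesis
      using nz by simp
  qed
  with c(1,2) have "c 0 \<noteq> 0"
    by (metis less_Suc_eq_0_disj)
  moreover have "c 0 *\<^sub>R x = 0"
    using rel c_Suc by simp
  ultimately show ?thesis by simp
qed

text \<open>Wherever a permutation puts \<open>x\<close>, it becomes an argument of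
  \<open>\<alpha>\<close> or of one factor \<open>\<omega>\<close>, and that factor is 0.\<close>

lemma alternate_linear_pair_prod_kernel:
  assumes "\<alpha> x = 0" "\<And>y. \<omega> x y = 0" "\<And>y. \<omega> y x = 0" "i < Suc (2 * n)" "v i = x"
  shows "alternate (Suc (2 * n)) (linear_pair_prod \<alpha> \<omega> n) v = 0"
  unfolding alternate_def
proof (intro sum.neutral ballI)
  fix p assume "p \<in> {p. p permutes {..<Suc (2 * n)}}"
  then have p: "p permutes {..<Suc (2 * n)}" by simp
  obtain j where j: "p j = i" "j < Suc (2 * n)"
    using permutes_inverses(1)[OF p] permutes_in_image[OF permutes_inv[OF p], of i] assms(4)
    by (metis lessThan_iff)
  have "linear_pair_prod \<alpha> \<omega> n (\<lambda>k. v (p k)) = 0"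
  proof (cases j)
    case 0
    then show ?thesis using j assms by (simp add: linear_pair_prod_def)
  next
    case (Suc k)
    \<comment> \<open>Slot 0 belongs to \<open>\<alpha>\<close>, so \<open>x\<close> lies in the
      pair \<open>k div 2\<close>, as first or second entry according to the parity of
      \<open>k\<close>.\<close>
    then have "k div 2 < n" using j by simp
    moreover have "\<omega> (v (p (Suc (2 * (k div 2))))) (v (p (Suc (Suc (2 * (k div 2)))))) = 0"
    proof (cases "even k")
      case True
      then show ?thesis using j Suc assms by simp
    next
      case False
      then have "Suc (2 * (k div 2)) = k" by presburger
      then show ?thesis using j Suc assms by simp
    qed
    ultimately show ?thesis
      by (auto simp: linear_pair_prod_def pair_prod_def)
  qed
  then show "real_of_int (sign p) * linear_pair_prod \<alpha> \<omega> n (\<lambda>k. v (p k)) = 0"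
    by simp
qed

lemma inj_imp_surj_if_dim_pos:
  fixes f :: "'a::real_vector \<Rightarrow> 'a"
  assumes "0 < dim (UNIV :: 'a set)" "linear f" "inj f"
  shows "surj f"
proof -
  obtain B :: "'a set" where B: "independent B" "UNIV \<subseteq> span B" "card B = dim (UNIV :: 'a set)"
    using basis_exists by metis
  then have "finite B"
    using assms(1) card_ge_0_finite by metis
  then interpret finite_dimensional_vector_space "scaleR :: real \<Rightarrow> 'a \<Rightarrow> 'a" B
    using B by unfold_locales (auto simp: dependent_raw_def span_raw_def)
  show ?thesis
    using linear_inj_imp_surj[of f] assms(2,3) by (simp add: linear_def)
qed

text \<open>An embedded basis together with \<open>ext_e\<close> and \<open>ext_d\<close> is again a
  basis. Positive dimension makes it finite, so its cardinality does grow by two.\<close>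

lemma dim_double_extension:
  assumes "0 < dim (UNIV :: 'a::real_vector set)"
  shows "dim (UNIV :: (real \<times> 'a \<times> real) set) = Suc (Suc (dim (UNIV :: 'a set)))"
proof -
  obtain B :: "'a set" where B: "independent B" "UNIV \<subseteq> span B" "card B = dim (UNIV :: 'a set)"
    using basis_exists by metis
  then have "finite B"
    using assms card_ge_0_finite by metis
  have lin: "linear (ext_in :: 'a \<Rightarrow> _)"
    by (simp add: linear_iff ext_in_def)
  have inj: "inj (ext_in :: 'a \<Rightarrow> _)"
    by (simp add: inj_def ext_in_def)
  have span: "span (ext_in ` B) = range ext_in"
    using B(2) by (simp add: linear_span_image[OF lin] top.extremum_unique)
  have e: "ext_e \<notin> range (ext_in :: 'a \<Rightarrow> _)"
    by (auto simp: ext_e_def ext_in_def)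
  have span_e: "span (insert ext_e (ext_in ` B)) = {0} \<times> UNIV"
    unfolding span_insert span by (auto simp: ext_e_def ext_in_def image_iff)
  let ?C = "insert ext_d (insert ext_e (ext_in ` B))"
  have d: "ext_d \<notin> span (insert ext_e (ext_in ` B))"
    unfolding span_e by (simp add: ext_d_def)
  have "independent (ext_in ` B)"
    using B(1) inj by (intro linear_independent_injective_image[OF lin]) (auto intro: inj_on_subset)
  then have "independent ?C"
    using d e by (metis independent_insert span span_base)
  moreover have "(u :: real \<times> 'a \<times> real) \<in> span ?C" for u
    unfolding span_insert[of ext_d] span_e
    by (cases u) (auto simp: ext_d_def intro!: exI[of _ "fst u"])
  moreover have "card ?C = Suc (Suc (card B))"
    using d e \<open>finite B\<close> card_image[OF inj_on_subset[OF inj subset_UNIV], of B]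
    by (metis (no_types, lifting) card_insert_disjoint finite_imageI finite_insert image_mono
      span_base subsetD subset_UNIV)
  ultimately show ?thesis
    using B(3) dim_eq_card[of ?C UNIV] by (metis UNIV_eq_I span_UNIV)
qed

subsection \<open>Cosymplectic Lie algebras and their double extensions\<close>

lemma double_ext_form_triple:
  "double_ext_form \<alpha> \<omega> (a, x, b) (a', x', b') = \<omega> x x' + \<alpha> x * b' - \<alpha> x' * b"
  by (simp add: double_ext_form_def ext_form2_def ext_form1_def wedge11_def dual_e_def)

locale cosymplectic =
  fixes br :: "'a::real_vector \<Rightarrow> 'a \<Rightarrow> 'a" and \<alpha> :: "'a \<Rightarrow> real" and \<omega> :: "'a \<Rightarrow> 'a \<Rightarrow> real"
  assumes cosymplectic: "cosymplectic_lie_algebra br \<alpha> \<omega>"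
begin

lemma bilinear_br: "bilinear br"
  and br_self: "br x x = 0"
  and jacobi: "br (br x y) z + br (br y z) x + br (br z x) y = 0"
  and linear_alpha: "linear \<alpha>"
  and bilinear_omega: "bilinear \<omega>"
  and omega_self: "\<omega> x x = 0"
  and alpha_br: "\<alpha> (br x y) = 0"
  and omega_cocycle: "\<omega> (br x y) z + \<omega> (br y z) x + \<omega> (br z x) y = 0"
  using cosymplectic
  by (auto simp: cosymplectic_lie_algebra_def lie_algebra_def alternating_form_def)

lemmas br_simps = bilinear_ladd[OF bilinear_br] bilinear_radd[OF bilinear_br]
  bilinear_lsub[OF bilinear_br] bilinear_rsub[OF bilinear_br]
  bilinear_lmul[OF bilinear_br] bilinear_rmul[OF bilinear_br]
  bilinear_lzero[OF bilinear_br] bilinear_rzero[OF bilinear_br]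
  bilinear_lneg[OF bilinear_br] bilinear_rneg[OF bilinear_br]

lemmas omega_simps = bilinear_ladd[OF bilinear_omega] bilinear_radd[OF bilinear_omega]
  bilinear_lsub[OF bilinear_omega] bilinear_rsub[OF bilinear_omega]
  bilinear_lmul[OF bilinear_omega] bilinear_rmul[OF bilinear_omega]
  bilinear_lzero[OF bilinear_omega] bilinear_rzero[OF bilinear_omega]
  bilinear_lneg[OF bilinear_omega] bilinear_rneg[OF bilinear_omega]

lemmas alpha_simps = linear_add[OF linear_alpha] linear_diff[OF linear_alpha]
  linear_scale[OF linear_alpha] linear_0[OF linear_alpha] linear_neg[OF linear_alpha]

lemma br_anti: "br x y = - br y x"
proof -
  have "br x y + br y x = 0"
    using br_self[of "x + y"] br_self[of x] br_self[of y] by (simp add: br_simps add.commute)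
  then show ?thesis
    by (simp add: eq_neg_iff_add_eq_0)
qed

lemma omega_anti: "\<omega> x y = - \<omega> y x"
proof -
  have "\<omega> x y + \<omega> y x = 0"
    using omega_self[of "x + y"] omega_self[of x] omega_self[of y] by (simp add: omega_simps)
  then show ?thesis
    by (simp add: eq_neg_iff_add_eq_0)
qed

section \<open>Non-degeneracy and the Reeb vector\<close>

lemma top_form_nonzero:
  obtains n v where "dim (UNIV :: 'a set) = Suc (2 * n)"
    and "alternate (Suc (2 * n)) (linear_pair_prod \<alpha> \<omega> n) v \<noteq> 0"
proof -
  obtain n where n: "dim (UNIV :: 'a set) = 2 * n + 1"
      "wedge 1 (2 * n) (form1 \<alpha>) (wedge_power2 \<omega> n) \<noteq> (\<lambda>v. 0)"
    using cosymplectic by (auto simp: cosymplectic_lie_algebra_def)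
  then obtain v where "wedge 1 (2 * n) (form1 \<alpha>) (wedge_power2 \<omega> n) v \<noteq> 0"
    by blast
  then show ?thesis
    using that[of n v] n(1) by (simp only: wedge_form1_wedge_power2) simp
qed

text \<open>A vector annihilated by both forms kills the top form in every slot, which a non-zero
  top form permits only for 0.\<close>

lemma kernel_trivial:
  assumes "\<alpha> x = 0" "\<And>y. \<omega> x y = 0"
  shows "x = 0"
proof -
  obtain n v where n: "dim (UNIV :: 'a set) = Suc (2 * n)"
    and v: "alternate (Suc (2 * n)) (linear_pair_prod \<alpha> \<omega> n) v \<noteq> 0"
    by (rule top_form_nonzero)
  have "\<omega> y x = 0" for y
    using assms(2)[of y] omega_anti[of y x] by simp
  with v n show ?thesis
    by (intro alternate_degenerate[where F = "linear_pair_prod \<alpha> \<omega> n"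
          and m = "Suc (2 * n)" and v = v and x = x])
      (simp_all add: linear_linear_pair_prod_upd linear_alpha bilinear_omega assms
        alternate_linear_pair_prod_kernel[where x = x])
qed

text \<open>The bilinear form \<open>\<omega> + \<alpha> \<otimes> \<alpha>\<close> is
  non-degenerate, so in finite dimension it identifies vectors with linear forms.\<close>

lemma dual_representation:
  assumes "linear f"
  obtains w where "\<And>z. \<omega> w z + \<alpha> w * \<alpha> z = f z"
proof -
  let ?b = "\<lambda>x z. \<omega> x z + \<alpha> x * \<alpha> z"
  have dim: "0 < dim (UNIV :: 'a set)"
    by (rule top_form_nonzero) simp
  obtain B :: "'a set" where B: "independent B" "UNIV \<subseteq> span B" "card B = dim (UNIV :: 'a set)"
    using basis_exists by metis
  then have fin: "finite B"
    using dim card_ge_0_finite by metis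
  have lin: "linear (?b x)" for x
    by (simp add: linear_iff omega_simps alpha_simps algebra_simps)
  \<comment> \<open>A linear form is encoded by the vector whose coordinates are its values on
    \<open>B\<close>. This makes the map from \<open>x\<close> to \<open>?b x\<close> an
    endomorphism, for which injectivity implies surjectivity.\<close>
  define \<Phi> where "\<Phi> x = (\<Sum>z\<in>B. ?b x z *\<^sub>R z)" for x
  have lin_Phi: "linear \<Phi>"
    by (simp add: linear_iff \<Phi>_def omega_simps alpha_simps algebra_simps sum.distrib scaleR_sum_right)
  have coeffs_eq: "g z = k z"
    if "(\<Sum>z\<in>B. g z *\<^sub>R z) = (\<Sum>z\<in>B. k z *\<^sub>R z)" "linear g" "linear k" for g k z
  proof (rule linear_eq_on[OF that(2,3)])
    show "z \<in> span B" using B(2) by blast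
    have "(\<Sum>z\<in>B. (g z - k z) *\<^sub>R z) = 0"
      using that(1) by (simp add: scaleR_diff_left sum_subtractf)
    then show "g b = k b" if "b \<in> B" for b
      using independentD[OF B(1) fin order_refl, of "\<lambda>z. g z - k z"] that by simp
  qed
  have "inj \<Phi>"
    unfolding linear_injective_0[OF lin_Phi]
  proof (intro allI impI)
    fix x assume "\<Phi> x = 0"
    then have b: "?b x z = 0" for z
      using coeffs_eq[of "?b x" "\<lambda>_. 0" z] lin by (simp add: \<Phi>_def linear_zero)
    \<comment> \<open>On the diagonal only the square of \<open>\<alpha> x\<close> remains.\<close>
    from b[of x] have "\<alpha> x = 0"
      by (simp add: omega_self)
    with b show "x = 0"
      by (intro kernel_trivial) auto
  qed
  then have "surj \<Phi>"
    using inj_imp_surj_if_dim_pos[OF dim lin_Phi] by blast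
  then obtain w where "\<Phi> w = (\<Sum>z\<in>B. f z *\<^sub>R z)"
    by (metis surj_def)
  then show ?thesis
    using coeffs_eq[of "?b w" f] lin assms by (intro that[of w]) (simp add: \<Phi>_def)
qed

text \<open>Let \<open>w\<close> represent \<open>\<alpha>\<close> under
  \<open>\<omega> + \<alpha> \<otimes> \<alpha>\<close>. Evaluation at \<open>w\<close> shows that
  \<open>\<alpha> w\<close> is 0 or 1, and the value 1 leaves \<open>\<omega> w x = 0\<close> for
  all \<open>x\<close>.\<close>

lemma reeb_exists:
  obtains w where "\<alpha> w = 1" "\<And>x. \<omega> w x = 0"
proof -
  obtain w where w: "\<And>z. \<omega> w z + \<alpha> w * \<alpha> z = \<alpha> z"
    using dual_representation[OF linear_alpha] by blast
  \<comment> \<open>Otherwise \<open>\<alpha> = \<iota>\<^sub>w \<omega>\<close>, and \<open>\<alpha> \<and> \<omega>\<^sup>n\<close> is a contraction of \<open>\<omega>\<^sup>n\<^sup>+\<^sup>1\<close>, which has too large a degree.\<close>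
  have "\<alpha> w \<noteq> 0"
  proof
    assume "\<alpha> w = 0"
    then have eq: "\<omega> w = \<alpha>"
      using w by auto
    obtain n v where n: "dim (UNIV :: 'a set) = Suc (2 * n)"
      and v: "alternate (Suc (2 * n)) (linear_pair_prod \<alpha> \<omega> n) v \<noteq> 0"
      by (rule top_form_nonzero)
    have "alternate (2 * Suc n) (pair_prod \<omega> (Suc n)) (case_nat w v) = 0"
      using n by (intro alternate_eq_0_if_dim_less linear_pair_prod_upd bilinear_omega) auto
    then show False
      using alternate_pair_prod_contract[of \<omega> n "case_nat w v", OF omega_anti] v eq by simp
  qed
  moreover have "\<alpha> w * \<alpha> w = \<alpha> w"
    using w[of w] by (simp add: omega_self)
  ultimately have "\<alpha> w = 1" by simp
  then show ?thesis
    using w that by simp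
qed

lemma reeb_eqI:
  assumes "\<alpha> w = 1" "\<And>x. \<omega> w x = 0"
  shows "reeb_vector \<alpha> \<omega> = w"
  unfolding reeb_vector_def
proof (rule the_equality)
  fix y assume "\<alpha> y = 1 \<and> (\<forall>x. \<omega> y x = 0)"
  then have "y - w = 0"
    using assms by (intro kernel_trivial) (auto simp: alpha_simps omega_simps)
  then show "y = w" by simp
qed (use assms in auto)

lemma reeb_vector: "\<alpha> (reeb_vector \<alpha> \<omega>) = 1" "\<omega> (reeb_vector \<alpha> \<omega>) x = 0"
  by (metis reeb_exists reeb_eqI)+

lemma omega_reeb_right: "\<omega> x (reeb_vector \<alpha> \<omega>) = 0"
  using reeb_vector(2)[of x] omega_anti[of x] by simp

lemma reeb_decomposition:
  obtains y where "\<alpha> y = 0" "x = y + \<alpha> x *\<^sub>R reeb_vector \<alpha> \<omega>"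
  using that[of "x - \<alpha> x *\<^sub>R reeb_vector \<alpha> \<omega>"] by (simp add: alpha_simps reeb_vector)

lemma nondegenerate_on_kernel:
  assumes "\<alpha> w = 0" "\<And>z. \<alpha> z = 0 \<Longrightarrow> \<omega> w z = 0"
  shows "w = 0"
proof (rule kernel_trivial[OF assms(1)])
  fix z
  obtain y where "\<alpha> y = 0" "z = y + \<alpha> z *\<^sub>R reeb_vector \<alpha> \<omega>"
    by (rule reeb_decomposition)
  then show "\<omega> w z = 0"
    using assms(2) by (metis omega_reeb_right omega_simps(2,6) add_0 scaleR_zero_right)
qed

text \<open>Once the description is shown to have exactly one solution, the product is 0 precisely
  when 0 satisfies it.\<close>

lemma left_symmetric_product_eq_0_iff:
  "left_symmetric_product br \<omega> {x. \<alpha> x = 0} y x = 0 \<longleftrightarrow> (\<forall>z. \<alpha> z = 0 \<longrightarrow> \<omega> x (br y z) = 0)"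
proof -
  let ?P = "\<lambda>w. w \<in> {x. \<alpha> x = 0} \<and> (\<forall>z\<in>{x. \<alpha> x = 0}. \<omega> w z = - \<omega> x (br y z))"
  have "linear (\<lambda>z. - \<omega> x (br y z))"
    by (simp add: linear_iff omega_simps br_simps)
  then obtain w where w: "\<And>z. \<omega> w z + \<alpha> w * \<alpha> z = - \<omega> x (br y z)"
    using dual_representation by blast
  \<comment> \<open>Removing the Reeb component moves \<open>w\<close> into the kernel of
    \<open>\<alpha>\<close> without changing \<open>\<omega> w\<close>.\<close>
  have "?P (w - \<alpha> w *\<^sub>R reeb_vector \<alpha> \<omega>)"
    using w by (auto simp: alpha_simps omega_simps reeb_vector) (metis add.right_neutral mult_zero_right)
  moreover have "w = w'" if "?P w" "?P w'" for w w'
  proof -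
    have "w - w' = 0"
      using that by (intro nondegenerate_on_kernel) (auto simp: alpha_simps omega_simps)
    then show ?thesis by simp
  qed
  ultimately have ex1: "\<exists>!w. ?P w" by blast
  have "left_symmetric_product br \<omega> {x. \<alpha> x = 0} y x = 0 \<longleftrightarrow> ?P 0"
  proof
    assume "left_symmetric_product br \<omega> {x. \<alpha> x = 0} y x = 0"
    moreover have "?P (left_symmetric_product br \<omega> {x. \<alpha> x = 0} y x)"
      unfolding left_symmetric_product_def by (rule theI'[OF ex1])
    ultimately show "?P 0" by presburger
  next
    assume "?P 0"
    then show "left_symmetric_product br \<omega> {x. \<alpha> x = 0} y x = 0"
      unfolding left_symmetric_product_def by (rule the1_equality[OF ex1])
  qed
  then show ?thesis
    by (auto simp: alpha_simps omega_simps)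
qed

section \<open>Forms and bracket of the double extension\<close>

lemma double_ext_form_alternating: "alternating_form (double_ext_form \<alpha> \<omega>)"
  by (auto simp: alternating_form_def bilinear_def linear_iff double_ext_form_triple omega_simps
      alpha_simps omega_self algebra_simps)

text \<open>The witness prepends \<open>d\<close> and \<open>e\<close> to one for the original
  algebra: \<open>dual_d\<close> consumes \<open>d\<close>, and contraction with \<open>e\<close>
  lowers the power of the 2-form by one.\<close>

lemma double_ext_top_form_nonzero:
  assumes "alternate (Suc (2 * n)) (linear_pair_prod \<alpha> \<omega> n) v \<noteq> 0"
  shows "alternate (Suc (2 * Suc n)) (linear_pair_prod dual_d (double_ext_form \<alpha> \<omega>) (Suc n))
    (case_nat ext_d (case_nat ext_e (\<lambda>i. ext_in (v i)))) \<noteq> 0"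
proof -
  let ?\<Omega> = "double_ext_form \<alpha> \<omega>"
  let ?w = "case_nat ext_e (\<lambda>i. ext_in (v i))"
  have anti: "?\<Omega> x y = - ?\<Omega> y x" for x y
    using omega_anti[of "fst (snd x)" "fst (snd y)"]
    by (cases x; cases y) (simp add: double_ext_form_triple)
  have "dual_d (?w i) = 0" for i
    by (cases i) (auto simp: dual_d_def ext_e_def ext_in_def)
  then have "alternate (Suc (2 * Suc n)) (linear_pair_prod dual_d ?\<Omega> (Suc n)) (case_nat ext_d ?w) =
      alternate (2 * Suc n) (pair_prod ?\<Omega> (Suc n)) ?w"
    by (subst alternate_linear_pair_prod_annihilated) (simp_all add: dual_d_def ext_d_def)
  also have "\<dots> = real (2 * Suc n) *
      alternate (Suc (2 * n)) (linear_pair_prod (?\<Omega> ext_e) ?\<Omega> n) (\<lambda>i. ext_in (v i))"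
    by (subst alternate_pair_prod_contract[OF anti]) simp
  \<comment> \<open>On embedded vectors \<open>?\<Omega> ext_e\<close> is \<open>- \<alpha>\<close>
    and \<open>?\<Omega>\<close> is \<open>\<omega>\<close>.\<close>
  also have "alternate (Suc (2 * n)) (linear_pair_prod (?\<Omega> ext_e) ?\<Omega> n) (\<lambda>i. ext_in (v i)) =
      - alternate (Suc (2 * n)) (linear_pair_prod \<alpha> \<omega> n) v"
    by (simp add: alternate_def linear_pair_prod_def pair_prod_def ext_e_def ext_in_def
        double_ext_form_triple omega_simps alpha_simps sum_negf)
  finally show ?thesis
    using assms by simp
qed

text \<open>The Jacobi identity at \<open>d, x, y\<close> has the derivation rule as its middle
  component and \<open>lam (br x y) = 0\<close> as its last; at \<open>d, e, x\<close> it says that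
  \<open>v\<close> is central. Conversely, with these rules the general identity reduces to the one
  of \<open>br\<close>.\<close>

lemma lie_algebra_double_ext_iff:
  assumes "linear \<phi>" "linear lam"
  shows "lie_algebra (double_ext_bracket br \<phi> lam v t) \<longleftrightarrow>
    \<phi> \<in> derivations br \<and> v \<in> lie_center br \<and> (\<forall>x y. lam (br x y) = 0)"
    (is "lie_algebra ?B \<longleftrightarrow> ?R")
proof
  assume "lie_algebra ?B"
  then have jac: "?B (?B u u') u'' + ?B (?B u' u'') u + ?B (?B u'' u) u' = 0" for u u' u''
    unfolding lie_algebra_def by blast
  note simps = double_ext_bracket_def br_simps linear_0[OF assms(1)] linear_0[OF assms(2)]
    linear_neg[OF assms(1)] linear_neg[OF assms(2)] zero_prod_def
  have "\<phi> (br x y) = br (\<phi> x) y + br x (\<phi> y)" for x y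
    using jac[of "(1, 0, 0)" "(0, x, 0)" "(0, y, 0)"] br_anti[of "\<phi> y" x]
    by (simp add: simps algebra_simps)
  moreover have "br v x = 0" for x
    using jac[of "(1, 0, 0)" "(0, 0, 1)" "(0, x, 0)"] by (simp add: simps)
  moreover have "lam (br x y) = 0" for x y
    using jac[of "(1, 0, 0)" "(0, x, 0)" "(0, y, 0)"] by (simp add: simps)
  ultimately show ?R
    using assms(1) by (simp add: derivations_def lie_center_def)
next
  assume ?R
  then have der: "\<phi> (br x y) = br (\<phi> x) y - br (\<phi> y) x"
    and v: "br v x = 0" "br x v = 0" and lam: "lam (br x y) = 0" for x y
    using br_anti[of x "\<phi> y"] br_anti[of x v] by (simp_all add: derivations_def lie_center_def)
  note simps = double_ext_bracket_def br_simps zero_prod_def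
    linear_add[OF assms(1)] linear_diff[OF assms(1)] linear_scale[OF assms(1)]
    linear_add[OF assms(2)] linear_diff[OF assms(2)] linear_scale[OF assms(2)]
  have "?B (?B u u') u'' + ?B (?B u' u'') u + ?B (?B u'' u) u' = 0" for u u' u''
  proof -
    obtain a x b a' x' b' a'' x'' b'' where
      u: "u = (a, x, b)" "u' = (a', x', b')" "u'' = (a'', x'', b'')"
      by (metis prod_cases3)
    have j: "br (br x x') x'' = - br (br x' x'') x - br (br x'' x) x'"
      using jacobi[of x x' x''] by (simp add: algebra_simps eq_neg_iff_add_eq_0)
    show ?thesis
      unfolding u
      by (simp add: simps der[of x x'] der[of x' x''] der[of x'' x] v lam j algebra_simps)
  qed
  moreover have "?B u u = 0" for u
    by (rule double_ext_bracket_alternating) (rule br_self)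
  ultimately show "lie_algebra ?B"
    using bilinear_double_ext_bracket[OF bilinear_br assms] by (simp add: lie_algebra_def)
qed

text \<open>Both arguments are split into a part in the kernel of \<open>\<alpha>\<close> and a
  multiple of the Reeb vector; the mixed brackets are governed by \<open>br c \<xi>\<close>.\<close>

lemma annihilates_brackets_iff:
  "(\<forall>x y. \<omega> (br x y) c = 0) \<longleftrightarrow>
    (\<forall>x y. \<alpha> x = 0 \<longrightarrow> \<alpha> y = 0 \<longrightarrow> \<omega> (br x y) c = 0) \<and> br c (reeb_vector \<alpha> \<omega>) = 0"
  (is "?L \<longleftrightarrow> ?R")
proof -
  let ?\<xi> = "reeb_vector \<alpha> \<omega>"
  \<comment> \<open>The third term of the cocycle identity, \<open>\<omega> (br c x) \<xi>\<close>,
    is 0.\<close>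
  have reeb: "\<omega> (br x ?\<xi>) c = \<omega> (br c ?\<xi>) x" for x
    using omega_cocycle[of x ?\<xi> c] br_anti[of c ?\<xi>] by (simp add: omega_reeb_right omega_simps)
  show ?thesis
  proof
    assume ?L
    then have "\<omega> (br c ?\<xi>) x = 0" for x
      using reeb by metis
    then have "br c ?\<xi> = 0"
      by (intro kernel_trivial alpha_br)
    with \<open>?L\<close> show ?R by blast
  next
    assume R: ?R
    then have reeb0: "\<omega> (br x ?\<xi>) c = 0" "\<omega> (br ?\<xi> x) c = 0" for x
      using reeb[of x] br_anti[of ?\<xi> x] by (simp_all add: omega_simps)
    show ?L
    proof (intro allI)
      fix x y
      obtain x0 where x0: "\<alpha> x0 = 0" "x = x0 + \<alpha> x *\<^sub>R ?\<xi>" by (rule reeb_decomposition)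
      obtain y0 where y0: "\<alpha> y0 = 0" "y = y0 + \<alpha> y *\<^sub>R ?\<xi>" by (rule reeb_decomposition)
      have "\<omega> (br (x0 + \<alpha> x *\<^sub>R ?\<xi>) (y0 + \<alpha> y *\<^sub>R ?\<xi>)) c = 0"
        using R x0(1) y0(1) by (simp add: br_simps omega_simps reeb0)
      then show "\<omega> (br x y) c = 0"
        using x0(2) y0(2) by simp
    qed
  qed
qed

text \<open>Conditions \<open>i\<close> to \<open>iv\<close> combine into two identities on the
  whole space, \<open>phi_v\<close> and \<open>skew\<close>; with closedness of
  \<open>\<omega>\<close> and \<open>\<alpha>\<close> they give every component of the
  claim.\<close>

lemma double_ext_form_closed:
  fixes \<phi> :: "'a \<Rightarrow> 'a" and lam :: "'a \<Rightarrow> real"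
  defines "\<xi> \<equiv> reeb_vector \<alpha> \<omega>"
  assumes lin: "linear \<phi>" "linear lam"
    and i: "\<And>x y. \<alpha> x = 0 \<Longrightarrow> \<alpha> y = 0 \<Longrightarrow> \<omega> (\<phi> x) y = - \<omega> x (\<phi> y)"
    and ii: "\<And>x. \<alpha> x = 0 \<Longrightarrow> lam x = \<omega> x (\<phi> \<xi>)"
    and iii: "\<And>x. \<alpha> x = 0 \<Longrightarrow> \<omega> v x = \<alpha> (\<phi> x)"
    and iv: "t = - \<alpha> (\<phi> \<xi>)"
  defines "B \<equiv> double_ext_bracket br \<phi> lam v t" and "\<Omega> \<equiv> double_ext_form \<alpha> \<omega>"
  shows "\<Omega> (B u u') u'' + \<Omega> (B u' u'') u + \<Omega> (B u'' u) u' = 0"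
proof -
  \<comment> \<open>This is closedness at \<open>d, x, e\<close>: \<open>iii\<close> covers the
    kernel of \<open>\<alpha>\<close> and \<open>iv\<close> the Reeb direction.\<close>
  have phi_v: "\<alpha> (\<phi> x) = \<omega> v x - t * \<alpha> x" for x
  proof -
    obtain y where y: "\<alpha> y = 0" "x = y + \<alpha> x *\<^sub>R \<xi>"
      unfolding \<xi>_def by (rule reeb_decomposition)
    have "\<alpha> (\<phi> x) = \<alpha> (\<phi> y) + \<alpha> x * \<alpha> (\<phi> \<xi>)"
      by (subst y(2)) (simp add: linear_add[OF lin(1)] linear_scale[OF lin(1)] alpha_simps)
    moreover have "\<omega> v x = \<omega> v y"
      by (subst y(2)) (simp add: omega_simps omega_reeb_right \<xi>_def)
    ultimately show ?thesis
      using iii[OF y(1)] iv by simp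
  qed
  \<comment> \<open>This is closedness at \<open>d, x, y\<close>: \<open>i\<close> covers pairs in
    the kernel and \<open>ii\<close> the mixed terms with the Reeb vector.\<close>
  have skew: "\<omega> (\<phi> x) y - \<omega> (\<phi> y) x = \<alpha> y * lam x - \<alpha> x * lam y" for x y
  proof -
    obtain x0 where x0: "\<alpha> x0 = 0" "x = x0 + \<alpha> x *\<^sub>R \<xi>"
      unfolding \<xi>_def by (rule reeb_decomposition)
    obtain y0 where y0: "\<alpha> y0 = 0" "y = y0 + \<alpha> y *\<^sub>R \<xi>"
      unfolding \<xi>_def by (rule reeb_decomposition)
    define a b where "a = \<alpha> x" and "b = \<alpha> y"
    have x: "x = x0 + a *\<^sub>R \<xi>" and y: "y = y0 + b *\<^sub>R \<xi>"
      using x0 y0 by (simp_all add: a_def b_def)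
    have \<xi>: "\<omega> z \<xi> = 0" "\<alpha> \<xi> = 1" for z
      by (simp_all add: \<xi>_def omega_reeb_right reeb_vector)
    show ?thesis
      unfolding x y
      using i[OF x0(1) y0(1)] ii[OF x0(1)] ii[OF y0(1)] omega_anti[of x0 "\<phi> y0"]
        omega_anti[of x0 "\<phi> \<xi>"] omega_anti[of y0 "\<phi> \<xi>"] x0(1) y0(1)
      by (simp add: \<xi> linear_add[OF lin(1)] linear_scale[OF lin(1)] linear_add[OF lin(2)]
          linear_scale[OF lin(2)] alpha_simps omega_simps algebra_simps)
  qed
  obtain a x b a' x' b' a'' x'' b'' where
    u: "u = (a, x, b)" "u' = (a', x', b')" "u'' = (a'', x'', b'')"
    by (metis prod_cases3)
  have s: "\<omega> (\<phi> x') x = \<omega> (\<phi> x) x' - \<alpha> x' * lam x + \<alpha> x * lam x'"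
    "\<omega> (\<phi> x'') x' = \<omega> (\<phi> x') x'' - \<alpha> x'' * lam x' + \<alpha> x' * lam x''"
    "\<omega> (\<phi> x) x'' = \<omega> (\<phi> x'') x - \<alpha> x * lam x'' + \<alpha> x'' * lam x"
    using skew[of x x'] skew[of x' x''] skew[of x'' x] by simp_all
  have c: "\<omega> (br x x') x'' = - \<omega> (br x' x'') x - \<omega> (br x'' x) x'"
    using omega_cocycle[of x x' x''] by simp
  show ?thesis
    unfolding u B_def \<Omega>_def
    by (simp add: double_ext_bracket_def double_ext_form_triple omega_simps alpha_simps alpha_br
        phi_v s c algebra_simps)
qed

text \<open>For uniqueness, pairing with the embedded Reeb vector isolates \<open>b\<close> and
  pairing with \<open>e\<close> isolates \<open>\<alpha> x\<close>; then non-degeneracy gives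
  \<open>x = 0\<close>.\<close>

lemma reeb_vector_double_ext:
  "reeb_vector dual_d (double_ext_form \<alpha> \<omega>) = ext_d"
  unfolding reeb_vector_def
proof (rule the_equality)
  show "dual_d (ext_d :: real \<times> 'a \<times> real) = 1 \<and> (\<forall>x. double_ext_form \<alpha> \<omega> ext_d x = 0)"
    by (auto simp: dual_d_def ext_d_def double_ext_form_triple omega_simps alpha_simps)
next
  fix u :: "real \<times> 'a \<times> real"
  assume u: "dual_d u = 1 \<and> (\<forall>x. double_ext_form \<alpha> \<omega> u x = 0)"
  obtain a x b where abx: "u = (a, x, b)" by (metis prod_cases3)
  have form: "\<omega> x x' + \<alpha> x * b' - \<alpha> x' * b = 0" for x' b'
    using u abx double_ext_form_triple by metis
  have "b = 0"
    using form[of "reeb_vector \<alpha> \<omega>" 0] by (simp add: omega_reeb_right reeb_vector)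
  moreover have "\<alpha> x = 0"
    using form[of 0 1] by (simp add: omega_simps alpha_simps)
  ultimately have "x = 0"
    using form[of _ 0] by (intro kernel_trivial) auto
  with \<open>b = 0\<close> u abx show "u = ext_d"
    by (simp add: dual_d_def ext_d_def)
qed

end

theorem theorem3p1:
  fixes br :: "'a::real_vector \<Rightarrow> 'a \<Rightarrow> 'a"
    and \<alpha> :: "'a \<Rightarrow> real" and \<omega> :: "'a \<Rightarrow> 'a \<Rightarrow> real"
    and \<xi> :: 'a and h :: "'a set"
    and \<phi> :: "'a \<Rightarrow> 'a" and lam :: "'a \<Rightarrow> real" and v :: 'a and t :: real
  assumes "cosymplectic_lie_algebra br \<alpha> \<omega>"
    and "\<xi> = reeb_vector \<alpha> \<omega>"
    and "h = {x. \<alpha> x = 0}"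
    and "linear \<phi>" and "linear lam"
    and "\<forall>x\<in>h. \<forall>y\<in>h. \<omega> (\<phi> x) y = - \<omega> x (\<phi> y)"
    and "\<forall>x\<in>h. lam x = \<omega> x (\<phi> \<xi>)"
    and "\<forall>x\<in>h. \<omega> v x = \<alpha> (\<phi> x)"
    and "t = - \<alpha> (\<phi> \<xi>)"
  shows "(cosymplectic_lie_algebra (double_ext_bracket br \<phi> lam v t) dual_d (double_ext_form \<alpha> \<omega>)
            \<longleftrightarrow> \<phi> \<in> derivations br \<and>
                v \<in> lie_center br \<and>
                (\<forall>y\<in>h. right_mult br \<omega> h (\<phi> \<xi>) y = 0) \<and> br (\<phi> \<xi>) \<xi> = 0) \<and>
         (cosymplectic_lie_algebra (double_ext_bracket br \<phi> lam v t) dual_d (double_ext_form \<alpha> \<omega>)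
            \<longrightarrow> reeb_vector dual_d (double_ext_form \<alpha> \<omega>) = ext_d)"
proof -
  interpret cosymplectic br \<alpha> \<omega>
    by unfold_locales (rule assms(1))
  let ?B = "double_ext_bracket br \<phi> lam v t" and ?\<Omega> = "double_ext_form \<alpha> \<omega>"
  \<comment> \<open>Brackets lie in the kernel of \<open>\<alpha>\<close>, where \<open>lam\<close>
    is given by \<open>\<omega>\<close>.\<close>
  have lam_br: "lam (br x y) = \<omega> (br x y) (\<phi> \<xi>)" for x y
    using assms(3,7) alpha_br by simp
  have "(\<forall>y\<in>h. right_mult br \<omega> h (\<phi> \<xi>) y = 0) \<longleftrightarrow>
      (\<forall>y z. \<alpha> y = 0 \<longrightarrow> \<alpha> z = 0 \<longrightarrow> \<omega> (br y z) (\<phi> \<xi>) = 0)"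
    unfolding right_mult_def assms(3) left_symmetric_product_eq_0_iff
    using omega_anti[of "\<phi> \<xi>"] by auto
  \<comment> \<open>With \<open>c = \<phi> \<xi>\<close>, both halves of the third condition
    together say that \<open>lam\<close> vanishes on all brackets.\<close>
  then have cond3: "(\<forall>y\<in>h. right_mult br \<omega> h (\<phi> \<xi>) y = 0) \<and> br (\<phi> \<xi>) \<xi> = 0 \<longleftrightarrow>
      (\<forall>x y. lam (br x y) = 0)"
    unfolding lam_br using annihilates_brackets_iff[of "\<phi> \<xi>"] assms(2) by simp
  have closed: "?\<Omega> (?B u u') u'' + ?\<Omega> (?B u' u'') u + ?\<Omega> (?B u'' u) u' = 0" for u u' u''
    using assms by (intro double_ext_form_closed) auto
  have dual_d_br: "dual_d (?B u u') = 0" for u u'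
    by (simp add: dual_d_def double_ext_bracket_def split_beta)
  obtain n w where n: "dim (UNIV :: 'a set) = Suc (2 * n)"
    and w: "alternate (Suc (2 * n)) (linear_pair_prod \<alpha> \<omega> n) w \<noteq> 0"
    by (rule top_form_nonzero)
  have "\<exists>n. dim (UNIV :: (real \<times> 'a \<times> real) set) = 2 * n + 1 \<and>
      wedge 1 (2 * n) (form1 dual_d) (wedge_power2 ?\<Omega> n) \<noteq> (\<lambda>v. 0)"
  proof (intro exI conjI)
    show "dim (UNIV :: (real \<times> 'a \<times> real) set) = 2 * Suc n + 1"
      using dim_double_extension[where 'a = 'a] n by simp
    show "wedge 1 (2 * Suc n) (form1 dual_d) (wedge_power2 ?\<Omega> (Suc n)) \<noteq> (\<lambda>v. 0)"
      using double_ext_top_form_nonzero[OF w] wedge_form1_wedge_power2[of "Suc n" dual_d ?\<Omega>]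
      by (metis divide_eq_0_iff power_not_zero zero_neq_numeral)
  qed
  \<comment> \<open>The requirements on the forms and on the dimension are now met, which leaves the
    Lie algebra axioms.\<close>
  then have "cosymplectic_lie_algebra ?B dual_d ?\<Omega> \<longleftrightarrow> lie_algebra ?B"
    using double_ext_form_alternating closed dual_d_br
    by (auto simp: cosymplectic_lie_algebra_def linear_iff dual_d_def)
  then show ?thesis
    unfolding lie_algebra_double_ext_iff[OF assms(4,5)] cond3[symmetric]
    using reeb_vector_double_ext by simp
qed

end
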